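(* Let $n\ge 3$ and let $T$ be a triangulation of a convex $n$-gon. Then the number $\mathrm{s}(T)$ of satisfying states of $T$ satisfies $$\mathrm{s}(T)\ \ge\ \varphi^{2}\,(\sqrt{\varphi})^{n},$$ where $\varphi=(1+\sqrt5)/2$ is the golden ratio (so $\sqrt{\varphi}\approx 1.27202$).
   Context: Let $C_n$ be a convex $n$-gon ($n\ge 3$), viewed as a cycle with $n$ vertices and $n$ edges. A triangulation of $C_n$ is a plane graph obtained from $C_n$ by adding $n-3$ new edges (pairwise non-crossing diagonals) so that $C_n$ is the boundary of its outer face; all its $n-2$ inner faces are triangles. A state of $T$ is a function $\sigma:V(T)\to\{1,-1\}$. A state $\sigma$ frustrates an edge $\{u,v\}$ if $\sigma(u)=\sigma(v)$. A state is satisfying if it frustrates exactly one edge of each triangular inner face of $T$. $\mathrm{s}(T)$ is the number of satisfying states of $T$. *)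

theory Defs
  imports "HOL-Analysis.Analysis"
begin

text \<open>
  A graph drawn with straight edges in the plane: the vertices are \<open>0, \<dots>, n - 1\<close>, vertex \<open>i\<close> is
  placed at the point \<open>p i\<close>, and an edge is a two-element set of vertices.
\<close>

text \<open>
  The points \<open>p 0, \<dots>, p (n - 1)\<close> are the vertices of a (strictly) convex polygon, listed in
  counterclockwise order. The quantity tested is the signed area (up to a factor 2) of the
  triangle \<open>p i, p j, p k\<close>. Every convex polygon has such a listing of its vertices.
\<close>
definition convex_polygon :: "nat \<Rightarrow> (nat \<Rightarrow> complex) \<Rightarrow> bool" where
  "convex_polygon n p \<longleftrightarrow>
     (\<forall>i j k. i < j \<and> j < k \<and> k < n \<longrightarrow> Im (cnj (p j - p i) * (p k - p i)) > 0)"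

definition sides :: "nat \<Rightarrow> nat set set" where
  "sides n = {{i, Suc i mod n} | i. i < n}"

definition diagonals :: "nat \<Rightarrow> nat set set" where
  "diagonals n = {{i, j} | i j. i < n \<and> j < n \<and> i \<noteq> j} - sides n"

definition drawn_edge :: "(nat \<Rightarrow> complex) \<Rightarrow> nat set \<Rightarrow> complex set" where
  "drawn_edge p e = convex hull (p ` e)"

text \<open>Distinct edges of a plane graph meet at most in the images of their common endpoints.\<close>
definition non_crossing :: "(nat \<Rightarrow> complex) \<Rightarrow> nat set set \<Rightarrow> bool" where
  "non_crossing p E \<longleftrightarrow>
     pairwise (\<lambda>d e. drawn_edge p d \<inter> drawn_edge p e \<subseteq> p ` (d \<inter> e)) E"

definition polygon_triangulation :: "nat \<Rightarrow> (nat \<Rightarrow> complex) \<Rightarrow> nat set set \<Rightarrow> bool" where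
  "polygon_triangulation n p E \<longleftrightarrow>
     (\<exists>D \<subseteq> diagonals n. card D = n - 3 \<and> E = sides n \<union> D \<and> non_crossing p E)"

definition inner_faces :: "(nat \<Rightarrow> complex) \<Rightarrow> nat set set \<Rightarrow> complex set set" where
  "inner_faces p E = {F \<in> components (- (\<Union>e\<in>E. drawn_edge p e)). bounded F}"

definition face_edges :: "(nat \<Rightarrow> complex) \<Rightarrow> nat set set \<Rightarrow> complex set \<Rightarrow> nat set set" where
  "face_edges p E F = {e \<in> E. drawn_edge p e \<subseteq> frontier F}"

definition states :: "nat \<Rightarrow> (nat \<Rightarrow> int) set" where
  "states n = {..<n} \<rightarrow>\<^sub>E {1, -1}"

definition frustrates :: "(nat \<Rightarrow> int) \<Rightarrow> nat set \<Rightarrow> bool" where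
  "frustrates \<sigma> e \<longleftrightarrow> (\<exists>u v. e = {u, v} \<and> u \<noteq> v \<and> \<sigma> u = \<sigma> v)"

text \<open>
  All inner faces of a triangulation of a convex polygon are triangles, so no separate
  restriction to triangular inner faces is imposed.
\<close>
definition satisfying :: "(nat \<Rightarrow> complex) \<Rightarrow> nat set set \<Rightarrow> (nat \<Rightarrow> int) \<Rightarrow> bool" where
  "satisfying p E \<sigma> \<longleftrightarrow>
     (\<forall>F \<in> inner_faces p E. card {e \<in> face_edges p E F. frustrates \<sigma> e} = 1)"

definition num_satisfying_states :: "nat \<Rightarrow> (nat \<Rightarrow> complex) \<Rightarrow> nat set set \<Rightarrow> nat" where
  "num_satisfying_states n p E = card {\<sigma> \<in> states n. satisfying p E \<sigma>}"

definition golden_ratio :: real where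
  "golden_ratio = (1 + sqrt 5) / 2"

end

theory Submission
  imports Defs
begin

text \<open>
  A triangle has exactly one frustrated edge precisely when its three vertices do not all carry the
  same value, so a satisfying state is a 2-colouring without monochromatic triangular face.

  Such colourings are counted along a tree of triangles. Cut the polygon along a chord \<open>{i, j}\<close> and
  look at the part spanned by the vertices \<open>i, \<dots>, j\<close>. Let \<open>a\<close> be the number of its colourings with
  prescribed equal values at \<open>i\<close> and \<open>j\<close>, and \<open>b\<close> the number with prescribed unequal values; by the
  symmetry between 1 and -1 these do not depend on the values chosen. If the triangle on \<open>{i, j}\<close> has
  its third vertex at \<open>k\<close>, then the numbers of the two smaller parts combine to
  \<open>(a, b) = (b\<^sub>1 b\<^sub>2, a\<^sub>1 b\<^sub>2 + b\<^sub>1 a\<^sub>2)\<close>. A single side has \<open>a = b = 1\<close>. The relation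
  \<open>a \<le> b \<le> 2 a\<close> is inherited, and with it the product grows at least like
  \<open>a b \<ge> 2 (a\<^sub>1 b\<^sub>1) (a\<^sub>2 b\<^sub>2)\<close>, because
  \<open>a b = (a\<^sub>1 b\<^sub>1) b\<^sub>2\<^sup>2 + (a\<^sub>2 b\<^sub>2) b\<^sub>1\<^sup>2\<close> and \<open>b\<^sub>l \<ge> a\<^sub>l\<close>. Hence \<open>a b \<ge> 2 ^ (n - 2)\<close> for the
  whole polygon, and the arithmetic-geometric mean inequality gives
  \<open>s(T) = 2 (a + b) \<ge> 4 sqrt (a b) \<ge> 2 (sqrt 2) ^ n\<close>. From \<open>n = 3\<close> on this exceeds the golden ratio
  bound (\<open>golden_ratio_power_le\<close>). The counting is \<open>card_nae_states_glue\<close> and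
  \<open>triangulated_nae_states\<close>.

  It remains to see that the faces of the drawing are the triangles of such a tree. Crossing chords
  of a convex polygon meet geometrically, so the diagonals are combinatorially non-crossing. A
  non-crossing family has at most \<open>n - 3\<close> diagonals, and equality forces the recursive decomposition
  into triangles (\<open>card_chords\<close>). A bounded face lies strictly on the inner side of every line through
  a side of the polygon (\<open>face_inside_supporting_line\<close>); starting from the side \<open>{0, n - 1}\<close> one then
  descends in the tree to a triangle containing a point of the face (\<open>locate_triangle\<close>). Since no edge
  enters the open triangle and its boundary consists of edges, the face is that open triangle.
\<close>

section \<open>Orientation of point triples\<close>

text \<open>
  Twice the signed area of the triangle \<open>u, v, w\<close>: positive if \<open>w\<close> lies to the left of the directed
  line from \<open>u\<close> to \<open>v\<close>.
\<close>
definition orient :: "complex \<Rightarrow> complex \<Rightarrow> complex \<Rightarrow> real" where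
  "orient u v w = Im (cnj (v - u) * (w - u))"

lemma orient_rotate: "orient u v w = orient v w u"
  by (simp add: orient_def algebra_simps)

lemma orient_swap: "orient v u w = - orient u v w"
  by (simp add: orient_def algebra_simps)

lemma orient_degenerate [simp]: "orient u v u = 0" "orient u v v = 0" "orient u u v = 0"
  by (simp_all add: orient_def algebra_simps)

text \<open>
  As a function of its last argument, \<open>orient\<close> is affine with normal vector \<open>\<i> * (v - u)\<close>. This makes
  the facts on half-spaces applicable to the sets cut out by \<open>orient\<close>.
\<close>
lemma orient_eq_inner: "orient u v w = (\<i> * (v - u)) \<bullet> w - (\<i> * (v - u)) \<bullet> u"
  by (simp add: orient_def inner_complex_def algebra_simps)

lemma half_planes_eq:
  "{z. orient u v z < 0} = {z. (\<i> * (v - u)) \<bullet> z < (\<i> * (v - u)) \<bullet> u}"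
  "{z. orient u v z \<le> 0} = {z. (\<i> * (v - u)) \<bullet> z \<le> (\<i> * (v - u)) \<bullet> u}"
  "{z. orient u v z \<ge> 0} = {z. (\<i> * (v - u)) \<bullet> z \<ge> (\<i> * (v - u)) \<bullet> u}"
  "{z. orient u v z > 0} = {z. (\<i> * (v - u)) \<bullet> z > (\<i> * (v - u)) \<bullet> u}"
  by (auto simp: orient_eq_inner)

lemma convex_half_planes:
  "convex {z. orient u v z < 0}" "convex {z. orient u v z \<le> 0}" "convex {z. orient u v z \<ge> 0}"
  unfolding half_planes_eq
  by (rule convex_halfspace_lt convex_halfspace_le convex_halfspace_ge)+

lemma interior_half_plane:
  assumes "u \<noteq> v"
  shows "interior {z. orient u v z \<ge> 0} = {z. orient u v z > 0}"
  unfolding half_planes_eq using assms by (intro interior_halfspace_ge) simp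

lemma unbounded_open_halfspace:
  fixes a :: "'a::real_inner"
  assumes "a \<noteq> 0"
  shows "\<not> bounded {x. a \<bullet> x < b}"
proof
  assume "bounded {x. a \<bullet> x < b}"
  then obtain B where B: "\<And>x. a \<bullet> x < b \<Longrightarrow> norm x \<le> B"
    unfolding bounded_iff by blast
  \<comment> \<open>The point \<open>x\<close> lies on the line spanned by \<open>a\<close> at \<open>a \<bullet> x = - t\<close>; the first two terms
    of \<open>t\<close> put it into the half-space, the last one makes its norm exceed \<open>B\<close>.\<close>
  define t where "t = \<bar>b\<bar> + 1 + (\<bar>B\<bar> + 1) * norm a"
  define x where "x = (- t / (a \<bullet> a)) *\<^sub>R a"
  have a: "norm a > 0" using assms by simp
  have "(\<bar>B\<bar> + 1) * norm a \<ge> 0" by simp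
  then have t: "t > 0" "- t < b" unfolding t_def by linarith+
  have "a \<bullet> x = - t" using assms by (simp add: x_def)
  then have "norm x \<le> B" using B t by simp
  moreover have "norm x = t / norm a"
    using a t by (simp add: x_def power2_norm_eq_inner[symmetric] power2_eq_square)
  moreover have "t / norm a > B"
  proof -
    have "B * norm a \<le> \<bar>B\<bar> * norm a" using a by (intro mult_right_mono) auto
    then have "B * norm a < t" using a unfolding t_def distrib_right by linarith
    then show ?thesis using a by (simp add: field_simps)
  qed
  ultimately show False by simp
qed

lemma unbounded_half_plane: "u \<noteq> v \<Longrightarrow> \<not> bounded {z. orient u v z < 0}"
  unfolding half_planes_eq by (rule unbounded_open_halfspace) simp

text \<open>
  The barycentric coordinates of \<open>x\<close> are the areas of the triangles that \<open>x\<close> spans with the three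
  sides, divided by the total area.
\<close>
lemma triangle_mem_if_orient_nonneg:
  assumes pos: "orient u v w > 0"
    and x: "orient u v x \<ge> 0" "orient v w x \<ge> 0" "orient w u x \<ge> 0"
  shows "x \<in> convex hull {u, v, w}"
proof -
  let ?d = "orient u v w"
  have sum: "orient v w x + orient w u x + orient u v x = ?d"
    by (simp add: orient_def algebra_simps)
  have "?d *\<^sub>R x = orient v w x *\<^sub>R u + orient w u x *\<^sub>R v + orient u v x *\<^sub>R w"
    by (rule complex_eqI) (simp_all add: orient_def algebra_simps)
  then have "(1 / ?d) *\<^sub>R (?d *\<^sub>R x) =
      (1 / ?d) *\<^sub>R (orient v w x *\<^sub>R u + orient w u x *\<^sub>R v + orient u v x *\<^sub>R w)"
    by simp
  then have x_eq: "x = (orient v w x / ?d) *\<^sub>R u + (orient w u x / ?d) *\<^sub>R v + (orient u v x / ?d) *\<^sub>R w"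
    using pos by (simp add: scaleR_add_right)
  have sum_eq: "orient v w x / ?d + orient w u x / ?d + orient u v x / ?d = 1"
    using pos sum by (simp add: add_divide_distrib[symmetric])
  have "orient v w x / ?d \<ge> 0" "orient w u x / ?d \<ge> 0" "orient u v x / ?d \<ge> 0"
    using pos x by simp_all
  with x_eq sum_eq show ?thesis unfolding convex_hull_3 by blast
qed

lemma triangle_subset_half_plane:
  assumes "orient u v w \<ge> 0"
  shows "convex hull {u, v, w} \<subseteq> {z. orient u v z \<ge> 0}"
  using assms by (intro hull_minimal convex_half_planes) auto

lemma orient_pos_if_interior_triangle:
  assumes pos: "orient u v w > 0" and x: "x \<in> interior (convex hull {u, v, w})"
  shows "orient u v x > 0" "orient v w x > 0" "orient w u x > 0"
proof -
  have *: "orient a b x > 0" if "orient a b c > 0" "{a, b, c} = {u, v, w}" for a b c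
  proof -
    have "a \<noteq> b" using that(1) by auto
    have "interior (convex hull {u, v, w}) \<subseteq> interior {z. orient a b z \<ge> 0}"
      using triangle_subset_half_plane[of a b c] that by (intro interior_mono) simp
    then show ?thesis using x interior_half_plane[OF \<open>a \<noteq> b\<close>] by auto
  qed
  show "orient u v x > 0" "orient v w x > 0" "orient w u x > 0"
    using *[of u v w] *[of v w u] *[of w u v] pos
    by (auto simp: orient_rotate[of u v w] orient_rotate[of v w u] insert_commute)
qed

text \<open>
  The point \<open>b\<close> lies to the right of the line \<open>a c\<close> and \<open>d\<close> to its left, so weighting \<open>b\<close> and \<open>d\<close> by the areas
  on the opposite side gives the point of the segment \<open>b d\<close> on that line. The same recipe with the two
  diagonals exchanged gives the same point, which therefore lies on both.
\<close>
lemma quadrilateral_diagonals_meet: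
  assumes "orient a b c > 0" "orient a b d > 0" "orient a c d > 0" "orient b c d > 0"
  shows "convex hull {a, c} \<inter> convex hull {b, d} \<noteq> {}"
proof -
  define s where "s = orient a c d + orient a b c"
  have s: "s > 0" using assms by (simp add: s_def)
  have s': "s = orient b c d + orient a b d"
    by (simp add: s_def orient_def algebra_simps)
  define z where "z = (1 / s) *\<^sub>R (orient a c d *\<^sub>R b + orient a b c *\<^sub>R d)"
  have z': "z = (1 / s) *\<^sub>R (orient b c d *\<^sub>R a + orient a b d *\<^sub>R c)"
    unfolding z_def by (rule arg_cong[where f = "\<lambda>y. (1 / s) *\<^sub>R y"], rule complex_eqI)
      (simp_all add: orient_def algebra_simps)
  have mem: "(1 / s) *\<^sub>R (\<alpha> *\<^sub>R x + \<beta> *\<^sub>R y) \<in> convex hull {x, y}"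
    if "\<alpha> \<ge> 0" "\<beta> \<ge> 0" "s = \<alpha> + \<beta>" for \<alpha> \<beta> and x y :: complex
  proof -
    have "(1 / s) *\<^sub>R (\<alpha> *\<^sub>R x + \<beta> *\<^sub>R y) = (\<alpha> / s) *\<^sub>R x + (\<beta> / s) *\<^sub>R y"
      by (simp add: scaleR_add_right)
    moreover have "\<alpha> / s + \<beta> / s = 1" using s that by (simp add: add_divide_distrib[symmetric])
    ultimately show ?thesis
      unfolding convex_hull_2 using s that
      by (intro CollectI exI[of _ "\<alpha> / s"] exI[of _ "\<beta> / s"]) simp
  qed
  have "z \<in> convex hull {b, d}"
    unfolding z_def using assms by (intro mem) (auto simp: s_def)
  moreover have "z \<in> convex hull {a, c}"
    unfolding z' using assms s' by (intro mem) auto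
  ultimately show ?thesis by blast
qed

section \<open>Non-crossing chords and trees of triangles\<close>

text \<open>
  The binary tree of triangles filling the part of the polygon on the vertices \<open>i, \<dots>, j\<close>. A triangle is
  recorded as the increasing triple of its vertices, and all its sides belong to \<open>E\<close>.
\<close>
inductive triangulated :: "nat set set \<Rightarrow> nat \<Rightarrow> nat \<Rightarrow> (nat \<times> nat \<times> nat) set \<Rightarrow> bool"
  for E where
  side: "{i, Suc i} \<in> E \<Longrightarrow> triangulated E i (Suc i) {}"
| glue: "{i, j} \<in> E \<Longrightarrow> triangulated E i k \<Delta> \<Longrightarrow> triangulated E k j \<Delta>'
    \<Longrightarrow> triangulated E i j (insert (i, k, j) (\<Delta> \<union> \<Delta>'))"

lemma triangulated_less: "triangulated E i j \<Delta> \<Longrightarrow> i < j"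
  by (induction rule: triangulated.induct) auto

lemma triangulated_edge: "triangulated E i j \<Delta> \<Longrightarrow> {i, j} \<in> E"
  by (induction rule: triangulated.induct) auto

lemma triangulated_triangle:
  assumes "triangulated E i j \<Delta>" "(a, b, c) \<in> \<Delta>"
  shows "i \<le> a \<and> a < b \<and> b < c \<and> c \<le> j \<and> {a, b} \<in> E \<and> {b, c} \<in> E \<and> {a, c} \<in> E"
  using assms
proof (induction rule: triangulated.induct)
  case (glue i j k \<Delta> \<Delta>')
  then show ?case
    using triangulated_less[OF glue.hyps(2)] triangulated_less[OF glue.hyps(3)]
      triangulated_edge[OF glue.hyps(2)] triangulated_edge[OF glue.hyps(3)]
    by fastforce
qed simp

text \<open>
  The edges within \<open>{i..j}\<close> that are not of the form \<open>{a, a + 1}\<close>. The edge \<open>{i, j}\<close> itself counts when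
  \<open>j \<ge> i + 2\<close>, so for the whole polygon the side \<open>{0, n - 1}\<close> is one of them.
\<close>
definition chords :: "nat set set \<Rightarrow> nat \<Rightarrow> nat \<Rightarrow> (nat \<times> nat) set" where
  "chords E i j = {(a, b). i \<le> a \<and> a + 2 \<le> b \<and> b \<le> j \<and> {a, b} \<in> E}"

lemma finite_chords [simp]: "finite (chords E i j)"
  by (rule finite_subset[of _ "{i..j} \<times> {i..j}"]) (auto simp: chords_def)

text \<open>
  Let \<open>k\<close> be the farthest neighbour of \<open>i\<close> before \<open>j\<close>. A chord other than \<open>{i, j}\<close> cannot jump over \<open>k\<close>: from
  \<open>i\<close> this would contradict the choice of \<open>k\<close>, and from a vertex between \<open>i\<close> and \<open>k\<close> it would cross \<open>{i, k}\<close>.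
  Thus the chords split into those on \<open>{i..k}\<close>, those on \<open>{k..j}\<close> and possibly \<open>{i, j}\<close>, and the bound
  follows by induction. If it is attained, then all three contributions are maximal; in particular
  \<open>{i, j}\<close> is an edge, which yields the root triangle.
\<close>
lemma card_chords:
  assumes noncrossing: "\<And>a b c d. a < b \<Longrightarrow> b < c \<Longrightarrow> c < d \<Longrightarrow> d \<le> m \<Longrightarrow>
      {a, c} \<in> E \<Longrightarrow> {b, d} \<notin> E"
    and sides: "\<And>a. a < m \<Longrightarrow> {a, Suc a} \<in> E"
    and "i < j" "j \<le> m"
  shows "card (chords E i j) \<le> j - i - 1 \<and>
    (card (chords E i j) = j - i - 1 \<longrightarrow> (\<exists>\<Delta>. triangulated E i j \<Delta>))"
  using assms(3,4)
proof (induction "j - i" arbitrary: i j rule: less_induct)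
  case less
  show ?case
  proof (cases "j = Suc i")
    case True
    then have "chords E i j = {}" by (auto simp: chords_def)
    then show ?thesis using True sides[of i] less.prems by (auto intro: triangulated.side)
  next
    case False
    define k where "k = Max {b. i < b \<and> b < j \<and> {i, b} \<in> E}"
    have fin: "finite {b. i < b \<and> b < j \<and> {i, b} \<in> E}"
      by (rule finite_subset[of _ "{..j}"]) auto
    have "Suc i \<in> {b. i < b \<and> b < j \<and> {i, b} \<in> E}"
      using False less.prems sides[of i] by auto
    then have "k \<in> {b. i < b \<and> b < j \<and> {i, b} \<in> E}"
      unfolding k_def using fin by (intro Max_in) auto
    then have k: "i < k" "k < j" "{i, k} \<in> E" by auto
    have k_max: "b \<le> k" if "i < b" "b < j" "{i, b} \<in> E" for b
      unfolding k_def using fin that by (intro Max_ge) auto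
    have sub: "chords E i j - {(i, j)} \<subseteq> chords E i k \<union> chords E k j"
    proof (rule subrelI, rule UnCI)
      fix a b assume "(a, b) \<in> chords E i j - {(i, j)}" and "(a, b) \<notin> chords E k j"
      then have ab: "(a, b) \<in> chords E i j" "(a, b) \<noteq> (i, j)" "(a, b) \<notin> chords E k j"
        by auto
      have h: "i \<le> a" "a + 2 \<le> b" "b \<le> j" "{a, b} \<in> E"
        using ab(1) by (auto simp: chords_def)
      have "b \<le> k"
      proof (cases "a = i")
        case True
        then show ?thesis using h ab(2) k_max[of b] by auto
      next
        case False
        have "a < k" using ab(3) h by (auto simp: chords_def)
        then show ?thesis
          using noncrossing[of i a k b] False h k(3) less.prems by force
      qed
      then show "(a, b) \<in> chords E i k" using h by (auto simp: chords_def)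
    qed
    have IH1: "card (chords E i k) \<le> k - i - 1 \<and>
        (card (chords E i k) = k - i - 1 \<longrightarrow> (\<exists>\<Delta>. triangulated E i k \<Delta>))"
      using k less.prems by (intro less.hyps) auto
    have IH2: "card (chords E k j) \<le> j - k - 1 \<and>
        (card (chords E k j) = j - k - 1 \<longrightarrow> (\<exists>\<Delta>. triangulated E k j \<Delta>))"
      using k less.prems by (intro less.hyps) auto
    have inner: "card (chords E i j - {(i, j)}) \<le> card (chords E i k) + card (chords E k j)"
      by (rule order_trans[OF card_mono[OF _ sub] card_Un_le]) simp
    have total: "card (chords E i j) =
        card (chords E i j - {(i, j)}) + (if {i, j} \<in> E then 1 else 0)"
    proof (cases "{i, j} \<in> E")
      case True
      then have "(i, j) \<in> chords E i j" using False less.prems by (auto simp: chords_def)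
      then show ?thesis
        using True card.remove[of "chords E i j" "(i, j)"] by simp
    next
      case nE: False
      then have "(i, j) \<notin> chords E i j" by (auto simp: chords_def)
      then show ?thesis using nE by simp
    qed
    show ?thesis
    proof (intro conjI impI)
      show "card (chords E i j) \<le> j - i - 1"
        using total inner IH1 IH2 k by (auto split: if_splits)
    next
      assume tight: "card (chords E i j) = j - i - 1"
      then have "{i, j} \<in> E" "card (chords E i k) = k - i - 1" "card (chords E k j) = j - k - 1"
        using total inner IH1 IH2 k by (auto split: if_splits)
      then show "\<exists>\<Delta>. triangulated E i j \<Delta>"
        using IH1 IH2 by (blast intro: triangulated.glue)
    qed
  qed
qed

section \<open>Counting colourings of a tree of triangles\<close>

text \<open>
  The colourings of the vertices \<open>i, \<dots>, j\<close> with end values \<open>s\<close> and \<open>t\<close> in which no triangle of \<open>\<Delta>\<close> is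
  monochromatic (\<open>nae\<close> abbreviates not-all-equal).
\<close>
definition nae_states ::
    "nat \<Rightarrow> nat \<Rightarrow> (nat \<times> nat \<times> nat) set \<Rightarrow> int \<Rightarrow> int \<Rightarrow> (nat \<Rightarrow> int) set" where
  "nae_states i j \<Delta> s t = {\<sigma> \<in> {i..j} \<rightarrow>\<^sub>E {1, -1}. \<sigma> i = s \<and> \<sigma> j = t \<and>
     (\<forall>(a, b, c) \<in> \<Delta>. \<not> (\<sigma> a = \<sigma> b \<and> \<sigma> b = \<sigma> c))}"

lemma finite_nae_states [simp]: "finite (nae_states i j \<Delta> s t)"
  by (rule finite_subset[of _ "{i..j} \<rightarrow>\<^sub>E {1, -1}"]) (auto simp: nae_states_def intro: finite_PiE)

text \<open>
  Colourings of the two parts that agree at the common vertex \<open>k\<close> can be merged, and the merged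
  colouring determines both of them. The only new condition is the one on the triangle \<open>i, k, j\<close>.
\<close>
lemma card_nae_states_glue:
  assumes "i < k" "k < j"
    and \<Delta>: "\<And>a b c. (a, b, c) \<in> \<Delta> \<Longrightarrow> a \<le> k \<and> b \<le> k \<and> c \<le> k"
    and \<Delta>': "\<And>a b c. (a, b, c) \<in> \<Delta>' \<Longrightarrow> k \<le> a \<and> k \<le> b \<and> k \<le> c"
    and nae: "\<not> (s = r \<and> r = t)"
  shows "card (nae_states i k \<Delta> s r) * card (nae_states k j \<Delta>' r t)
    \<le> card {\<sigma> \<in> nae_states i j (insert (i, k, j) (\<Delta> \<union> \<Delta>')) s t. \<sigma> k = r}"
proof -
  define h where "h = (\<lambda>(f :: nat \<Rightarrow> int, g) x. if x \<le> k then f x else g x)"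
  let ?P = "nae_states i k \<Delta> s r \<times> nae_states k j \<Delta>' r t"
  let ?Q = "{\<sigma> \<in> nae_states i j (insert (i, k, j) (\<Delta> \<union> \<Delta>')) s t. \<sigma> k = r}"
  have right: "h (f, g) x = g x" if "(f, g) \<in> ?P" "k \<le> x" for f g x
    using that by (auto simp: h_def nae_states_def)
  have left: "h (f, g) x = f x" if "x \<le> k" for f g x
    using that by (simp add: h_def)
  have "inj_on h ?P"
  proof (rule inj_onI, clarify)
    fix f g f' g' assume fg: "f \<in> nae_states i k \<Delta> s r" "g \<in> nae_states k j \<Delta>' r t"
      and fg': "f' \<in> nae_states i k \<Delta> s r" "g' \<in> nae_states k j \<Delta>' r t"
      and eq: "h (f, g) = h (f', g')"
    have "f x = f' x" for x
    proof (cases "x \<le> k")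
      case True
      then show ?thesis using left[of x f g] left[of x f' g'] eq by simp
    next
      case False
      then have "x \<notin> {i..k}" by simp
      moreover have "f \<in> extensional {i..k}" "f' \<in> extensional {i..k}"
        using fg fg' by (auto simp: nae_states_def PiE_def)
      ultimately show ?thesis by (simp add: extensional_def)
    qed
    moreover have "g x = g' x" for x
    proof (cases "k \<le> x")
      case True
      then show ?thesis using right[of f g x] right[of f' g' x] eq fg fg' by simp
    next
      case False
      then have "x \<notin> {k..j}" by simp
      moreover have "g \<in> extensional {k..j}" "g' \<in> extensional {k..j}"
        using fg fg' by (auto simp: nae_states_def PiE_def)
      ultimately show ?thesis by (simp add: extensional_def)
    qed
    ultimately show "f = f' \<and> g = g'" by auto
  qed
  moreover have "h ` ?P \<subseteq> ?Q"
  proof safe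
    fix f g assume fg: "f \<in> nae_states i k \<Delta> s r" "g \<in> nae_states k j \<Delta>' r t"
    then have P: "(f, g) \<in> ?P" by simp
    have ends: "h (f, g) i = s" "h (f, g) k = r" "h (f, g) j = t"
      using left[of i f g] left[of k f g] right[OF P, of j] fg assms(1,2)
      by (auto simp: nae_states_def)
    show "h (f, g) k = r" by (rule ends)
    have "h (f, g) \<in> {i..j} \<rightarrow>\<^sub>E {1, -1}"
      using fg assms(1,2) by (auto simp: h_def nae_states_def PiE_def Pi_def extensional_def)
    moreover have "\<not> (h (f, g) a = h (f, g) b \<and> h (f, g) b = h (f, g) c)"
      if abc: "(a, b, c) \<in> insert (i, k, j) (\<Delta> \<union> \<Delta>')" for a b c
    proof -
      consider "(a, b, c) = (i, k, j)" | "(a, b, c) \<in> \<Delta>" | "(a, b, c) \<in> \<Delta>'"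
        using abc by blast
      then show ?thesis
      proof cases
        case 1
        then show ?thesis using ends nae by auto
      next
        case 2
        then show ?thesis using \<Delta>[OF 2] fg(1) by (auto simp: left nae_states_def)
      next
        case 3
        then show ?thesis using \<Delta>'[OF 3] fg(2) by (auto simp: right[OF P] nae_states_def)
      qed
    qed
    ultimately show "h (f, g) \<in> nae_states i j (insert (i, k, j) (\<Delta> \<union> \<Delta>')) s t"
      using ends unfolding nae_states_def by blast
  qed
  ultimately have "card ?P \<le> card ?Q"
    by (intro card_inj_on_le) auto
  then show ?thesis by (simp add: card_cartesian_product)
qed

text \<open>
  The arithmetic of one gluing step. The bounds by factors of 2 are needed because \<open>a \<le> b\<close> alone is
  not inherited: the new first component \<open>b * b'\<close> must not exceed the new second one.
\<close>
lemma nae_product_step: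
  fixes a b a' b' :: nat
  assumes "a \<le> b" "b \<le> 2 * a" "a' \<le> b'" "b' \<le> 2 * a'" "x \<le> a * b" "y \<le> a' * b'"
  shows "b * b' \<le> a * b' + b * a'" "a * b' + b * a' \<le> 2 * (b * b')"
    "2 * (x * y) \<le> (b * b') * (a * b' + b * a')"
proof -
  have "b * b' \<le> 2 * a * b'" by (rule mult_right_mono) (use assms in auto)
  moreover have "b * b' \<le> b * (2 * a')" by (rule mult_left_mono) (use assms in auto)
  moreover have "2 * a * b' = 2 * (a * b')" "b * (2 * a') = 2 * (b * a')" by simp_all
  ultimately show "b * b' \<le> a * b' + b * a'" by linarith
  have "a * b' \<le> b * b'" by (rule mult_right_mono) (use assms in auto)
  moreover have "b * a' \<le> b * b'" by (rule mult_left_mono) (use assms in auto)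
  ultimately show "a * b' + b * a' \<le> 2 * (b * b')" by linarith
  have "x * y \<le> (a * b) * (a' * b')" by (rule mult_mono) (use assms in auto)
  \<comment> \<open>The two summands of the new product are each at least \<open>(a * b) * (a' * b')\<close>.\<close>
  moreover have "(a * b) * (a' * b') \<le> (a * b) * (b' * b')"
    by (intro mult_left_mono mult_right_mono) (use assms in auto)
  moreover have "(a' * b') * (a * b) \<le> (a' * b') * (b * b)"
    by (intro mult_left_mono mult_right_mono) (use assms in auto)
  moreover have "(b * b') * (a * b' + b * a') = (a * b) * (b' * b') + (a' * b') * (b * b)"
    "(a' * b') * (a * b) = (a * b) * (a' * b')"
    by (simp_all add: algebra_simps)
  ultimately show "2 * (x * y) \<le> (b * b') * (a * b' + b * a')" by linarith
qed

text \<open>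
  The recursion \<open>(a, b) = (b\<^sub>1 b\<^sub>2, a\<^sub>1 b\<^sub>2 + b\<^sub>1 a\<^sub>2)\<close>, stated with lower bounds in place of exact counts
  so that only an injection is needed for gluing. Equal end values leave only the opposite value for
  the apex \<open>k\<close>; unequal end values leave both.
\<close>
lemma triangulated_nae_states:
  assumes "triangulated E i j \<Delta>"
  shows "\<exists>a b. a \<le> b \<and> b \<le> 2 * a \<and> 2 ^ (j - i - 1) \<le> a * b \<and>
    (\<forall>s \<in> {1, -1}. a \<le> card (nae_states i j \<Delta> s s) \<and> b \<le> card (nae_states i j \<Delta> s (- s)))"
  using assms
proof (induction rule: triangulated.induct)
  case (side i)
  have "1 \<le> card (nae_states i (Suc i) {} s t)" if "s \<in> {1, -1}" "t \<in> {1, -1}" for s t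
  proof -
    have "(\<lambda>x \<in> {i..Suc i}. if x = i then s else t) \<in> nae_states i (Suc i) {} s t"
      using that by (auto simp: nae_states_def)
    then show ?thesis by (metis One_nat_def Suc_leI card_gt_0_iff empty_iff finite_nae_states)
  qed
  then show ?case by (intro exI[of _ 1]) auto
next
  case (glue i j k \<Delta> \<Delta>')
  obtain a b where ab: "a \<le> b" "b \<le> 2 * a" "2 ^ (k - i - 1) \<le> a * b"
    and W: "\<And>s. s \<in> {1, -1} \<Longrightarrow>
      a \<le> card (nae_states i k \<Delta> s s) \<and> b \<le> card (nae_states i k \<Delta> s (- s))"
    using glue.IH(1) by blast
  obtain a' b' where ab': "a' \<le> b'" "b' \<le> 2 * a'" "2 ^ (j - k - 1) \<le> a' * b'"
    and W': "\<And>s. s \<in> {1, -1} \<Longrightarrow>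
      a' \<le> card (nae_states k j \<Delta>' s s) \<and> b' \<le> card (nae_states k j \<Delta>' s (- s))"
    using glue.IH(2) by blast
  note less = triangulated_less[OF glue.hyps(2)] triangulated_less[OF glue.hyps(3)]
  let ?\<Delta> = "insert (i, k, j) (\<Delta> \<union> \<Delta>')"
  let ?N = "\<lambda>s t r. {\<sigma> \<in> nae_states i j ?\<Delta> s t. \<sigma> k = r}"
  have N: "card (nae_states i k \<Delta> s r) * card (nae_states k j \<Delta>' r t) \<le> card (?N s t r)"
    if "\<not> (s = r \<and> r = t)" for s r t
    using triangulated_triangle[OF glue.hyps(2)] triangulated_triangle[OF glue.hyps(3)] that
    by (intro card_nae_states_glue less) fastforce+
  have "b * b' \<le> card (nae_states i j ?\<Delta> s s) \<and>
      a * b' + b * a' \<le> card (nae_states i j ?\<Delta> s (- s))" if s: "s \<in> {1, -1}" for s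
  proof
    have ms: "- s \<in> {1, -1}" and ne: "s \<noteq> - s" using s by auto
    have "b * b' \<le> card (nae_states i k \<Delta> s (- s)) * card (nae_states k j \<Delta>' (- s) s)"
      using W[OF s] W'[OF ms] by (intro mult_mono) auto
    also have "\<dots> \<le> card (?N s s (- s))" using ne by (intro N) auto
    also have "\<dots> \<le> card (nae_states i j ?\<Delta> s s)" by (intro card_mono) auto
    finally show "b * b' \<le> card (nae_states i j ?\<Delta> s s)" .
    have "a * b' \<le> card (nae_states i k \<Delta> s s) * card (nae_states k j \<Delta>' s (- s))"
      using W[OF s] W'[OF s] by (intro mult_mono) auto
    also have "\<dots> \<le> card (?N s (- s) s)" using ne by (intro N) auto
    finally have 1: "a * b' \<le> card (?N s (- s) s)" .
    have "b * a' \<le> card (nae_states i k \<Delta> s (- s)) * card (nae_states k j \<Delta>' (- s) (- s))"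
      using W[OF s] W'[OF ms] by (intro mult_mono) auto
    also have "\<dots> \<le> card (?N s (- s) (- s))" using ne by (intro N) auto
    finally have 2: "b * a' \<le> card (?N s (- s) (- s))" .
    have "card (?N s (- s) s) + card (?N s (- s) (- s))
        = card (?N s (- s) s \<union> ?N s (- s) (- s))"
      using ne by (intro card_Un_disjoint[symmetric]) auto
    also have "\<dots> \<le> card (nae_states i j ?\<Delta> s (- s))" by (intro card_mono) auto
    finally show "a * b' + b * a' \<le> card (nae_states i j ?\<Delta> s (- s))" using 1 2 by simp
  qed
  moreover have "2 * (2 ^ (k - i - 1) * 2 ^ (j - k - 1)) \<le> (b * b') * (a * b' + b * a')"
    by (rule nae_product_step(3)[OF ab(1,2) ab'(1,2) ab(3) ab'(3)])
  moreover have "(2::nat) * (2 ^ (k - i - 1) * 2 ^ (j - k - 1)) = 2 ^ (j - i - 1)"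
  proof -
    have "j - i - 1 = Suc ((k - i - 1) + (j - k - 1))" using less by simp
    then show ?thesis by (simp only: power_Suc power_add)
  qed
  ultimately show ?case
    using nae_product_step(1,2)[OF ab(1,2) ab'(1,2) ab(3) ab'(3)]
    by (intro exI[of _ "b * b'"] exI[of _ "a * b' + b * a'"]) auto
qed

text \<open>
  The four choices of end values contribute at least \<open>2 * a + 2 * b\<close> colourings, and
  \<open>(a + b)\<^sup>2 \<ge> 4 * (a * b)\<close>. The bound is squared to stay within the natural numbers.
\<close>
lemma power2_card_nae_ge:
  assumes T: "triangulated E 0 m \<Delta>"
  shows "4 * 2 ^ Suc m \<le> (card {\<sigma> \<in> {0..m} \<rightarrow>\<^sub>E {1, -1 :: int}.
    \<forall>(a, b, c) \<in> \<Delta>. \<not> (\<sigma> a = \<sigma> b \<and> \<sigma> b = \<sigma> c)})\<^sup>2"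
    (is "_ \<le> (card ?S)\<^sup>2")
proof -
  obtain a b where ab: "2 ^ (m - 0 - 1) \<le> a * b"
    and W: "\<And>s. s \<in> {1, -1} \<Longrightarrow>
      a \<le> card (nae_states 0 m \<Delta> s s) \<and> b \<le> card (nae_states 0 m \<Delta> s (- s))"
    using triangulated_nae_states[OF T] by blast
  let ?W = "\<lambda>(s, t). nae_states 0 m \<Delta> s t"
  let ?I = "{(1, 1), (-1, -1), (1, -1), (-1, 1)} :: (int \<times> int) set"
  have fin: "finite ?S"
    by (rule finite_subset[of _ "{0..m} \<rightarrow>\<^sub>E {1, -1}"]) (auto intro: finite_PiE)
  have "2 * a + 2 * b \<le> (\<Sum>x\<in>?I. card (?W x))"
    using W[of 1] W[of "-1"] by auto
  also have "\<dots> = card (\<Union>x\<in>?I. ?W x)"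
  proof (rule card_UN_disjoint[symmetric])
    show "\<forall>x\<in>?I. finite (?W x)" by (simp add: split_beta)
    show "\<forall>x\<in>?I. \<forall>y\<in>?I. x \<noteq> y \<longrightarrow> ?W x \<inter> ?W y = {}"
      by (auto simp: nae_states_def)
  qed simp
  also have "\<dots> \<le> card ?S"
    using fin by (intro card_mono) (auto simp: nae_states_def)
  finally have le: "2 * a + 2 * b \<le> card ?S" .
  have "m > 0" using triangulated_less[OF T] .
  then have "(2::nat) ^ Suc m = 4 * 2 ^ (m - 0 - 1)" by (cases m) auto
  then have "4 * 2 ^ Suc m \<le> 16 * (a * b)" using ab by simp
  also have "\<dots> \<le> (2 * a + 2 * b)\<^sup>2"
  proof -
    have "16 * (int a * int b) \<le> (2 * int a + 2 * int b)\<^sup>2"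
      using zero_le_power2[of "int a - int b"] by (simp add: power2_eq_square algebra_simps)
    then have "int (16 * (a * b)) \<le> int ((2 * a + 2 * b)\<^sup>2)" by simp
    then show ?thesis by (simp only: zle_int)
  qed
  also have "\<dots> \<le> (card ?S)\<^sup>2" using le by (rule power_mono) simp
  finally show ?thesis .
qed

section \<open>The faces of a triangulated convex polygon\<close>

text \<open>
  The open triangle is connected and avoids \<open>U\<close>, so it is contained in the component. Conversely, the
  component cannot leave the triangle without meeting its frontier, which lies in \<open>U\<close>.
\<close>
lemma frontier_component_triangle:
  fixes u v w :: complex
  assumes F: "F \<in> components (- U)" and x: "x \<in> F" "x \<in> convex hull {u, v, w}"
    and bd: "closed_segment u v \<union> closed_segment v w \<union> closed_segment w u \<subseteq> U"
    and disj: "interior (convex hull {u, v, w}) \<inter> U = {}"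
  shows "frontier F = closed_segment u v \<union> closed_segment v w \<union> closed_segment w u"
proof -
  let ?H = "convex hull {u, v, w}"
  have fr: "frontier ?H = closed_segment u v \<union> closed_segment v w \<union> closed_segment w u"
    by (rule frontier_of_triangle) simp
  have F_sub: "F \<subseteq> - U" using F by (rule in_components_subset)
  have "x \<notin> frontier ?H" using x(1) F_sub bd fr by blast
  then have xi: "x \<in> interior ?H"
    using x(2) closure_subset unfolding frontier_def by blast
  have "interior ?H \<subseteq> F"
    using F xi x(1) disj by (intro components_maximal[OF F]) (auto intro: convex_connected convex_interior)
  moreover have "F \<subseteq> ?H"
    using connected_Int_frontier[OF in_components_connected[OF F], of ?H] x F_sub bd fr by blast
  then have "F \<subseteq> interior ?H"
    using closure_subset F_sub bd fr unfolding frontier_def by blast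
  ultimately have F_eq: "F = interior ?H" by blast
  have "closure (interior ?H) = closure ?H"
    using xi by (intro convex_closure_interior) auto
  then have "frontier F = frontier ?H" by (simp add: F_eq frontier_def)
  then show "frontier F = closed_segment u v \<union> closed_segment v w \<union> closed_segment w u"
    by (simp add: fr)
qed

text \<open>
  The combinatorial and metric data that remain of a triangulated convex polygon. The vertices are
  \<open>0, \<dots>, m\<close>, so that \<open>m\<close> is both the last vertex and one less than the number of vertices.
\<close>
locale triangulated_convex_polygon =
  fixes m :: nat and p :: "nat \<Rightarrow> complex" and E :: "nat set set"
    and \<Delta> :: "(nat \<times> nat \<times> nat) set"
  assumes orient_pos: "\<And>i j k. i < j \<Longrightarrow> j < k \<Longrightarrow> k \<le> m \<Longrightarrow> orient (p i) (p j) (p k) > 0"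
    and m_ge: "m \<ge> 2"
    and edges: "\<And>e. e \<in> E \<Longrightarrow> \<exists>a b. e = {a, b} \<and> a < b \<and> b \<le> m"
    and noncrossing: "\<And>a b c d. a < b \<Longrightarrow> b < c \<Longrightarrow> c < d \<Longrightarrow> d \<le> m \<Longrightarrow>
      {a, c} \<in> E \<Longrightarrow> {b, d} \<notin> E"
    and triangulated: "triangulated E 0 m \<Delta>"
begin

text \<open>
  The vertices run counterclockwise, so those between \<open>a\<close> and \<open>b\<close> lie to the right of the chord from
  \<open>a\<close> to \<open>b\<close>, and the remaining ones to its left.
\<close>
lemma orient_inside:
  assumes "a < b" "b \<le> m" "a \<le> l" "l \<le> b"
  shows "orient (p a) (p b) (p l) \<le> 0"
proof (cases "l = a \<or> l = b")
  case False
  then have "orient (p a) (p l) (p b) > 0" using assms by (intro orient_pos) auto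
  then show ?thesis by (simp add: orient_def algebra_simps)
qed auto

lemma orient_outside:
  assumes "a < b" "b \<le> m" "l \<le> m" "l \<le> a \<or> b \<le> l"
  shows "orient (p a) (p b) (p l) \<ge> 0"
proof -
  consider "l = a \<or> l = b" | "l < a" | "b < l" using assms by linarith
  then show ?thesis
  proof cases
    case 2
    then have "orient (p l) (p a) (p b) > 0" using assms by (intro orient_pos) auto
    then show ?thesis by (simp add: orient_rotate[of "p l"])
  next
    case 3
    then show ?thesis using orient_pos[of a b l] assms by simp
  qed auto
qed

lemma inj_p:
  assumes "a < b" "b \<le> m"
  shows "p a \<noteq> p b"
proof -
  consider c where "c < a" | c where "a < c" "c < b" | c where "b < c" "c \<le> m"
  proof -
    have "0 < a \<or> a + 1 < b \<or> b < m" using assms m_ge by linarith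
    then show ?thesis using that(1)[of 0] that(2)[of "a + 1"] that(3)[of m] by auto
  qed
  then show ?thesis
  proof cases
    case 1
    then show ?thesis using orient_pos[of c a b] assms by auto
  next
    case 2
    then show ?thesis using orient_pos[of a c b] assms by auto
  next
    case 3
    then show ?thesis using orient_pos[of a b c] assms by auto
  qed
qed

abbreviation drawing :: "complex set" where
  "drawing \<equiv> \<Union>e\<in>E. drawn_edge p e"

lemma drawing_subset:
  assumes "convex S" "\<And>l. l \<le> m \<Longrightarrow> p l \<in> S"
  shows "drawing \<subseteq> S"
proof -
  have "drawn_edge p e \<subseteq> S" if e: "e \<in> E" for e
  proof -
    obtain a b where "e = {a, b}" "a < b" "b \<le> m" using edges[OF e] by blast
    then show ?thesis
      unfolding drawn_edge_def using assms by (intro hull_minimal) auto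
  qed
  then show ?thesis by blast
qed

text \<open>
  The open half-plane on the outer side of the line is connected, avoids all edges and is unbounded,
  so a bounded face cannot meet it. As the face is open, it cannot touch the line either: arbitrarily
  close to a point of the line there are points on the outer side.
\<close>
lemma face_inside_supporting_line:
  assumes F: "F \<in> inner_faces p E" and "u \<noteq> v"
    and side: "\<And>l. l \<le> m \<Longrightarrow> orient u v (p l) \<ge> 0"
    and x: "x \<in> F"
  shows "orient u v x > 0"
proof (rule ccontr)
  assume "\<not> orient u v x > 0"
  let ?H = "{z. orient u v z < 0}"
  have FC: "F \<in> components (- drawing)" and bF: "bounded F"
    using F by (auto simp: inner_faces_def)
  have "finite E"
    by (rule finite_subset[of _ "Pow {..m}"]) (use edges in fastforce)+
  moreover have "closed (drawn_edge p e)" if "e \<in> E" for e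
  proof -
    have "finite e" using edges[OF that] by auto
    then show ?thesis
      unfolding drawn_edge_def
      by (intro compact_imp_closed finite_imp_compact_convex_hull finite_imageI)
  qed
  ultimately have "open F"
    by (intro open_components[OF _ FC] open_Compl closed_UN) auto
  have "F \<inter> ?H \<noteq> {}"
  proof
    assume "F \<inter> ?H = {}"
    then have "interior F \<subseteq> interior {z. orient u v z \<ge> 0}"
      by (intro interior_mono) auto
    then have "x \<in> {z. orient u v z > 0}"
      using x \<open>open F\<close> interior_half_plane[OF \<open>u \<noteq> v\<close>] by (auto simp: interior_open)
    then show False using \<open>\<not> orient u v x > 0\<close> by simp
  qed
  moreover have "?H \<subseteq> - drawing"
    using drawing_subset[of "{z. orient u v z \<ge> 0}"] side convex_half_planes(3) by force
  ultimately have "?H \<subseteq> F"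
    by (intro components_maximal[OF FC] convex_connected convex_half_planes)
  then show False
    using unbounded_half_plane[OF \<open>u \<noteq> v\<close>] bF bounded_subset by blast
qed

text \<open>
  Descend in the tree: a point beyond the chord \<open>{i, j}\<close> is beyond \<open>{i, k}\<close>, beyond \<open>{k, j}\<close>, or in the
  triangle between the three chords. The descent cannot end at a side \<open>{i, i + 1}\<close>, since the point lies
  strictly on the inner side of it.
\<close>
lemma locate_triangle:
  assumes "triangulated E i j D"
    and "\<And>a. i \<le> a \<Longrightarrow> a < j \<Longrightarrow> orient (p a) (p (Suc a)) x > 0"
    and "orient (p i) (p j) x \<le> 0"
  shows "\<exists>(a, b, c) \<in> D. orient (p a) (p b) x \<ge> 0 \<and> orient (p b) (p c) x \<ge> 0 \<and>
    orient (p c) (p a) x \<ge> 0"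
  using assms
proof (induction rule: triangulated.induct)
  case (side i)
  show ?case using side.prems(1)[OF order_refl lessI] side.prems(2) by simp
next
  case (glue i j k D D')
  note less = triangulated_less[OF glue.hyps(2)] triangulated_less[OF glue.hyps(3)]
  consider "orient (p i) (p k) x \<le> 0" | "orient (p k) (p j) x \<le> 0"
    | "orient (p i) (p k) x \<ge> 0" "orient (p k) (p j) x \<ge> 0" by linarith
  then show ?case
  proof cases
    case 1
    then show ?thesis using glue.IH(1) glue.prems(1) less by force
  next
    case 2
    then show ?thesis using glue.IH(2) glue.prems(1) less by force
  next
    case 3
    then show ?thesis using glue.prems(2) orient_swap[of "p j" "p i" x] by auto
  qed
qed

text \<open>
  By the non-crossing property both ends of an edge lie in \<open>{i..k}\<close>, or both in \<open>{k..j}\<close>, or both outside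
  \<open>{i<..<j}\<close>. In each case one side of the triangle separates the edge from the open triangle.
\<close>
lemma edge_misses_triangle:
  assumes t: "(i, k, j) \<in> \<Delta>" and e: "e \<in> E"
  shows "interior (convex hull {p i, p k, p j}) \<inter> drawn_edge p e = {}"
proof -
  have T: "i < k" "k < j" "j \<le> m" "{i, k} \<in> E" "{k, j} \<in> E" "{i, j} \<in> E"
    using triangulated_triangle[OF triangulated t] by auto
  obtain a b where ab: "e = {a, b}" "a < b" "b \<le> m" using edges[OF e] by blast
  have abE: "{a, b} \<in> E" using e ab by simp
  have pos: "orient (p i) (p k) (p j) > 0" using T by (intro orient_pos)
  have *: "interior (convex hull {p i, p k, p j}) \<inter> drawn_edge p e = {}"
    if "orient u v (p a) \<le> 0" "orient u v (p b) \<le> 0"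
      "\<And>x. x \<in> interior (convex hull {p i, p k, p j}) \<Longrightarrow> orient u v x > 0" for u v
  proof -
    have "drawn_edge p e \<subseteq> {z. orient u v z \<le> 0}"
      unfolding drawn_edge_def ab using that
      by (intro hull_minimal convex_half_planes) auto
    then show ?thesis using that(3) by force
  qed
  consider "i \<le> a" "b \<le> k" | "k \<le> a" "b \<le> j" | "a \<le> i \<or> j \<le> a" "b \<le> i \<or> j \<le> b"
  proof -
    have "\<not> (a < i \<and> i < b \<and> b < j)" using noncrossing[of a i b j] T abE by auto
    moreover have "\<not> (i < a \<and> a < k \<and> k < b)" using noncrossing[of i a k b] T abE ab by auto
    moreover have "\<not> (a < k \<and> i \<le> a \<and> k < b \<and> b < j)"
      using noncrossing[of a k b j] T abE by auto
    moreover have "\<not> (i < a \<and> a < j \<and> j < b)" using noncrossing[of i a j b] T abE ab by auto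
    ultimately show ?thesis using that T ab by linarith
  qed
  then show ?thesis
  proof cases
    case 1
    then show ?thesis
      using T ab orient_pos_if_interior_triangle(1)[OF pos]
      by (intro *[of "p i" "p k"] orient_inside) auto
  next
    case 2
    then show ?thesis
      using T ab orient_pos_if_interior_triangle(2)[OF pos]
      by (intro *[of "p k" "p j"] orient_inside) auto
  next
    case 3
    then show ?thesis
      using T ab orient_pos_if_interior_triangle(3)[OF pos]
        orient_outside[of i j a] orient_outside[of i j b]
      by (intro *[of "p j" "p i"]) (auto simp: orient_swap[of "p j" "p i"])
  qed
qed

text \<open>
  Any other vertex is strictly separated from the triangle by one of its sides.
\<close>
lemma vertex_in_triangle:
  assumes "i < k" "k < j" "j \<le> m" "l \<le> m" "p l \<in> convex hull {p i, p k, p j}"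
  shows "l \<in> {i, k, j}"
proof (rule ccontr)
  assume l: "l \<notin> {i, k, j}"
  have pos: "orient (p i) (p k) (p j) > 0" using assms by (intro orient_pos)
  have ge: "orient (p i) (p k) (p l) \<ge> 0" "orient (p k) (p j) (p l) \<ge> 0"
      "orient (p j) (p i) (p l) \<ge> 0"
    using triangle_subset_half_plane[of "p i" "p k" "p j"]
      triangle_subset_half_plane[of "p k" "p j" "p i"]
      triangle_subset_half_plane[of "p j" "p i" "p k"] pos assms(5)
    by (auto simp: insert_commute orient_rotate[of "p i" "p k" "p j"]
        orient_rotate[of "p k" "p j" "p i"])
  consider "i < l" "l < k" | "k < l" "l < j" | "l < i" | "j < l" using l by fastforce
  then show False
  proof cases
    case 1
    then show False using orient_pos[of i l k] ge assms by (simp add: orient_def algebra_simps)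
  next
    case 2
    then show False using orient_pos[of k l j] ge assms by (simp add: orient_def algebra_simps)
  next
    case 3
    then show False using orient_pos[of l i j] ge assms by (simp add: orient_def algebra_simps)
  next
    case 4
    then show False using orient_pos[of i j l] ge assms by (simp add: orient_def algebra_simps)
  qed
qed

text \<open>
  Every bounded face is one of the triangles of the tree. Its frontier consists of three edges, and
  any further edge contained in the frontier would have its end points among the three corners, by
  convexity, and so would be one of the three.
\<close>
lemma inner_face_edges:
  assumes F: "F \<in> inner_faces p E"
  shows "\<exists>(i, k, j) \<in> \<Delta>. face_edges p E F = {{i, k}, {k, j}, {i, j}}"
proof -
  have FC: "F \<in> components (- drawing)" using F by (simp add: inner_faces_def)
  obtain x where x: "x \<in> F" using in_components_nonempty[OF FC] by blast
  have "orient (p a) (p (Suc a)) x > 0" if "a < m" for a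
    using that inj_p[of a "Suc a"]
    by (intro face_inside_supporting_line[OF F _ _ x] orient_outside) auto
  moreover have "orient (p m) (p 0) x > 0"
    using m_ge inj_p[of 0 m] orient_inside[of 0 m] orient_swap[of "p m" "p 0"]
    by (intro face_inside_supporting_line[OF F _ _ x]) force+
  then have "orient (p 0) (p m) x \<le> 0" using orient_swap[of "p m" "p 0" x] by simp
  ultimately obtain i k j where t: "(i, k, j) \<in> \<Delta>"
    and xt: "orient (p i) (p k) x \<ge> 0" "orient (p k) (p j) x \<ge> 0" "orient (p j) (p i) x \<ge> 0"
    using locate_triangle[OF triangulated, of x] by auto
  have T: "i < k" "k < j" "j \<le> m" "{i, k} \<in> E" "{k, j} \<in> E" "{i, j} \<in> E"
    using triangulated_triangle[OF triangulated t] by auto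
  have pos: "orient (p i) (p k) (p j) > 0" using T by (intro orient_pos)
  have seg: "drawn_edge p {a, b} = closed_segment (p a) (p b)" for a b
    by (simp add: drawn_edge_def segment_convex_hull)
  have fr: "frontier F =
      closed_segment (p i) (p k) \<union> closed_segment (p k) (p j) \<union> closed_segment (p j) (p i)"
  proof (rule frontier_component_triangle[OF FC x])
    show "x \<in> convex hull {p i, p k, p j}"
      using pos xt by (rule triangle_mem_if_orient_nonneg)
    show "closed_segment (p i) (p k) \<union> closed_segment (p k) (p j) \<union> closed_segment (p j) (p i)
        \<subseteq> drawing"
      using T(4-6) seg[of i k] seg[of k j] seg[of i j] closed_segment_commute[of "p i" "p j"]
      by blast
    show "interior (convex hull {p i, p k, p j}) \<inter> drawing = {}"
      using edge_misses_triangle[OF t] by blast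
  qed
  have "e \<in> {{i, k}, {k, j}, {i, j}}" if "e \<in> E" "drawn_edge p e \<subseteq> frontier F" for e
  proof -
    obtain a b where ab: "e = {a, b}" "a < b" "b \<le> m" using edges[OF \<open>e \<in> E\<close>] by blast
    have "frontier F \<subseteq> convex hull {p i, p k, p j}"
      unfolding fr segment_convex_hull by (intro Un_least hull_mono) auto
    then have "p a \<in> convex hull {p i, p k, p j}" "p b \<in> convex hull {p i, p k, p j}"
      using that(2) ab seg[of a b] by auto
    then have "a \<in> {i, k, j}" "b \<in> {i, k, j}"
      using ab T by (auto dest!: vertex_in_triangle[rotated -1])
    then show ?thesis using ab T by auto
  qed
  moreover have "drawn_edge p {i, k} \<subseteq> frontier F" "drawn_edge p {k, j} \<subseteq> frontier F"
      "drawn_edge p {i, j} \<subseteq> frontier F"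
    unfolding seg fr by (auto simp: closed_segment_commute)
  ultimately have "face_edges p E F = {{i, k}, {k, j}, {i, j}}"
    unfolding face_edges_def using T(4-6) by blast
  then show ?thesis using t by blast
qed

lemma satisfying_if_nae:
  assumes \<sigma>: "\<sigma> \<in> {0..m} \<rightarrow>\<^sub>E {1, -1}"
    and nae: "\<forall>(a, b, c) \<in> \<Delta>. \<not> (\<sigma> a = \<sigma> b \<and> \<sigma> b = \<sigma> c)"
  shows "satisfying p E \<sigma>"
  unfolding satisfying_def
proof
  fix F assume F: "F \<in> inner_faces p E"
  obtain i k j where t: "(i, k, j) \<in> \<Delta>"
    and fe: "face_edges p E F = {{i, k}, {k, j}, {i, j}}"
    using inner_face_edges[OF F] by auto
  have T: "i < k" "k < j" "j \<le> m"
    using triangulated_triangle[OF triangulated t] by auto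
  have fru: "frustrates \<sigma> {a, b} \<longleftrightarrow> \<sigma> a = \<sigma> b" if "a < b" for a b
    using that unfolding frustrates_def by (auto simp: doubleton_eq_iff)
  have v: "\<sigma> l = 1 \<or> \<sigma> l = -1" if "l \<le> m" for l using \<sigma> that by (auto simp: PiE_def Pi_def)
  have "\<not> (\<sigma> i = \<sigma> k \<and> \<sigma> k = \<sigma> j)" using nae t by auto
  then consider "\<sigma> i = \<sigma> k" "\<sigma> k \<noteq> \<sigma> j" "\<sigma> i \<noteq> \<sigma> j" | "\<sigma> k = \<sigma> j" "\<sigma> i \<noteq> \<sigma> k" "\<sigma> i \<noteq> \<sigma> j"
    | "\<sigma> i = \<sigma> j" "\<sigma> i \<noteq> \<sigma> k" "\<sigma> k \<noteq> \<sigma> j"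
    using v[of i] v[of k] v[of j] T by force
  then have "\<exists>e. {e \<in> face_edges p E F. frustrates \<sigma> e} = {e}"
  proof cases
    case 1
    then have "{e \<in> face_edges p E F. frustrates \<sigma> e} = {{i, k}}"
      unfolding fe using fru[of i k] fru[of k j] fru[of i j] T by auto
    then show ?thesis by blast
  next
    case 2
    then have "{e \<in> face_edges p E F. frustrates \<sigma> e} = {{k, j}}"
      unfolding fe using fru[of i k] fru[of k j] fru[of i j] T by auto
    then show ?thesis by blast
  next
    case 3
    then have "{e \<in> face_edges p E F. frustrates \<sigma> e} = {{i, j}}"
      unfolding fe using fru[of i k] fru[of k j] fru[of i j] T by auto
    then show ?thesis by blast
  qed
  then show "card {e \<in> face_edges p E F. frustrates \<sigma> e} = 1" by auto
qed

lemma power2_num_satisfying_states_ge: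
  "4 * 2 ^ Suc m \<le> (num_satisfying_states (Suc m) p E)\<^sup>2"
proof -
  have range: "{..<Suc m} = {0..m}" by auto
  have "finite {\<sigma> \<in> {0..m} \<rightarrow>\<^sub>E {1, -1}. satisfying p E \<sigma>}"
    by (rule finite_subset[of _ "{0..m} \<rightarrow>\<^sub>E {1, -1}"]) (auto intro: finite_PiE)
  then have "card {\<sigma> \<in> {0..m} \<rightarrow>\<^sub>E {1, -1 :: int}. \<forall>(a, b, c) \<in> \<Delta>. \<not> (\<sigma> a = \<sigma> b \<and> \<sigma> b = \<sigma> c)}
      \<le> num_satisfying_states (Suc m) p E"
    unfolding num_satisfying_states_def states_def range
    using satisfying_if_nae by - (rule card_mono; blast)
  then have "(card {\<sigma> \<in> {0..m} \<rightarrow>\<^sub>E {1, -1 :: int}. \<forall>(a, b, c) \<in> \<Delta>. \<not> (\<sigma> a = \<sigma> b \<and> \<sigma> b = \<sigma> c)})\<^sup>2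
      \<le> (num_satisfying_states (Suc m) p E)\<^sup>2"
    by (rule power_mono) simp
  then show ?thesis using power2_card_nae_ge[OF triangulated] by (rule order_trans[rotated])
qed

end

section \<open>From plane drawings to trees of triangles\<close>

lemma convex_polygon_noncrossing:
  assumes cp: "convex_polygon n p" and nc: "non_crossing p E"
    and "a < b" "b < c" "c < d" "d < n" "{a, c} \<in> E"
  shows "{b, d} \<notin> E"
proof
  assume "{b, d} \<in> E"
  have pos: "orient (p i) (p j) (p k) > 0" if "i < j" "j < k" "k < n" for i j k
    using cp that unfolding convex_polygon_def orient_def by blast
  have "convex hull {p a, p c} \<inter> convex hull {p b, p d} \<noteq> {}"
    using assms by (intro quadrilateral_diagonals_meet pos) auto
  moreover have ne: "{a, c} \<noteq> {b, d}" using assms by (auto simp: doubleton_eq_iff)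
  have "drawn_edge p {a, c} \<inter> drawn_edge p {b, d} \<subseteq> p ` ({a, c} \<inter> {b, d})"
    by (rule nc[unfolded non_crossing_def pairwise_def, rule_format, OF assms(7) \<open>{b, d} \<in> E\<close> ne])
  moreover have "{a, c} \<inter> {b, d} = {}" using assms by auto
  ultimately show False by (simp add: drawn_edge_def)
qed

lemma polygon_triangulation_edges:
  assumes "n \<ge> 3" "polygon_triangulation n p E"
  shows "e \<in> E \<Longrightarrow> \<exists>a b. e = {a, b} \<and> a < b \<and> b \<le> n - 1"
    and "a < n - 1 \<Longrightarrow> {a, Suc a} \<in> E"
    and "{0, n - 1} \<in> E"
proof -
  obtain D where D: "D \<subseteq> diagonals n" and E: "E = sides n \<union> D"
    using assms(2) unfolding polygon_triangulation_def by blast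
  have pair: "\<exists>a b. {i, j} = {a, b} \<and> a < b \<and> b \<le> n - 1" if "i < n" "j < n" "i \<noteq> j" for i j
  proof (cases "i < j")
    case True
    then show ?thesis using that by (intro exI[of _ i] exI[of _ j]) auto
  next
    case False
    then show ?thesis using that by (intro exI[of _ j] exI[of _ i]) auto
  qed
  show "\<exists>a b. e = {a, b} \<and> a < b \<and> b \<le> n - 1" if e: "e \<in> E"
  proof -
    consider i where "i < n" "e = {i, Suc i mod n}" | "e \<in> diagonals n"
      using e D unfolding E sides_def by blast
    then show ?thesis
    proof cases
      case 1
      have "Suc i mod n \<noteq> i" using 1(1) assms(1) by (cases "Suc i = n") auto
      then show ?thesis using 1 pair[of i "Suc i mod n"] assms(1) by auto
    next
      case 2
      then show ?thesis using pair unfolding diagonals_def by blast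
    qed
  qed
  show "{a, Suc a} \<in> E" if "a < n - 1"
    using that unfolding E sides_def by (auto intro!: exI[of _ a])
  have "{n - 1, Suc (n - 1) mod n} \<in> sides n" using assms(1) unfolding sides_def by fastforce
  then show "{0, n - 1} \<in> E" using assms(1) unfolding E by (simp add: insert_commute)
qed

text \<open>
  The \<open>n - 3\<close> diagonals together with the side \<open>{0, n - 1}\<close>, which \<open>chords\<close> also counts, attain the
  bound of \<open>card_chords\<close>.
\<close>
lemma polygon_triangulation_chords:
  assumes n: "n \<ge> 3" and T: "polygon_triangulation n p E"
  shows "n - 2 \<le> card (chords E 0 (n - 1))"
proof -
  obtain D where D: "D \<subseteq> diagonals n" "card D = n - 3" and E: "E = sides n \<union> D"
    using T unfolding polygon_triangulation_def by blast
  let ?C = "chords E 0 (n - 1)"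
  have "D \<subseteq> (\<lambda>(a, b). {a, b}) ` (?C - {(0, n - 1)})"
  proof
    fix e assume e: "e \<in> D"
    then obtain a b where ab: "e = {a, b}" "a < b" "b \<le> n - 1"
      using polygon_triangulation_edges(1)[OF n T, of e] E by blast
    have ns: "e \<notin> sides n" using e D(1) by (auto simp: diagonals_def)
    have "b \<noteq> Suc a"
    proof
      assume "b = Suc a"
      then have "e = {a, Suc a mod n}" using ab n by simp
      then show False using ns ab n unfolding sides_def by auto
    qed
    moreover have "(a, b) \<noteq> (0, n - 1)"
    proof
      assume "(a, b) = (0, n - 1)"
      then have "e = {n - 1, Suc (n - 1) mod n}" using ab n by auto
      then show False using ns n unfolding sides_def by auto
    qed
    ultimately have "(a, b) \<in> ?C - {(0, n - 1)}"
      using ab e E by (auto simp: chords_def)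
    then show "e \<in> (\<lambda>(a, b). {a, b}) ` (?C - {(0, n - 1)})"
      using ab(1) by (intro image_eqI[of _ _ "(a, b)"]) auto
  qed
  then have "card D \<le> card (?C - {(0, n - 1)})" by (intro surj_card_le) auto
  moreover have "(0, n - 1) \<in> ?C"
    using polygon_triangulation_edges(3)[OF n T] n by (auto simp: chords_def)
  then have "card ?C = Suc (card (?C - {(0, n - 1)}))" by (intro card.remove) auto
  ultimately show ?thesis using D(2) n by linarith
qed

lemma polygon_triangulation_tree:
  assumes n: "n \<ge> 3" and cp: "convex_polygon n p" and T: "polygon_triangulation n p E"
  obtains \<Delta> where "triangulated_convex_polygon (n - 1) p E \<Delta>"
proof -
  have nc: "non_crossing p E" using T unfolding polygon_triangulation_def by blast
  have cross: "{b, d} \<notin> E" if "a < b" "b < c" "c < d" "d \<le> n - 1" "{a, c} \<in> E" for a b c d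
    using that n by (intro convex_polygon_noncrossing[OF cp nc, of a b c d]) auto
  have "card (chords E 0 (n - 1)) \<le> n - 1 - 0 - 1 \<and>
      (card (chords E 0 (n - 1)) = n - 1 - 0 - 1 \<longrightarrow> (\<exists>\<Delta>. triangulated E 0 (n - 1) \<Delta>))"
    using n by (intro card_chords[where m = "n - 1"] cross polygon_triangulation_edges(2)[OF n T]) auto
  then obtain \<Delta> where "triangulated E 0 (n - 1) \<Delta>"
    using polygon_triangulation_chords[OF n T] by force
  then have "triangulated_convex_polygon (n - 1) p E \<Delta>"
  proof (unfold_locales)
    show "orient (p i) (p j) (p k) > 0" if "i < j" "j < k" "k \<le> n - 1" for i j k
      using cp that n unfolding convex_polygon_def orient_def by auto
  qed (use n polygon_triangulation_edges(1)[OF n T] cross in auto)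
  then show ?thesis by (rule that)
qed

section \<open>The golden ratio bound\<close>

text \<open>
  The square of the golden ratio bound is \<open>golden_ratio ^ (n + 4)\<close>. The golden ratio is less than 2, so
  only \<open>n = 3\<close> needs to be checked; there the seventh power is \<open>13 * golden_ratio + 8 \<approx> 29.03\<close>, below 32.
\<close>
lemma golden_ratio_power_le:
  assumes "n \<ge> 3"
  shows "golden_ratio ^ (n + 4) \<le> 4 * 2 ^ n"
  using assms
proof (induction n rule: dec_induct)
  case base
  let ?g = golden_ratio
  have sq: "?g * ?g = ?g + 1"
    by (simp add: golden_ratio_def field_simps)
  have "?g ^ 7 = 13 * ?g + 8"
    using sq by algebra
  moreover have "sqrt 5 \<le> 5 / 2" by (rule real_le_lsqrt) (simp_all add: power2_eq_square)
  then have "?g \<le> 7 / 4" by (simp add: golden_ratio_def)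
  ultimately show ?case by simp
next
  case (step n)
  have "sqrt 5 \<le> 3" by (rule real_le_lsqrt) simp_all
  then have g: "0 \<le> golden_ratio" "golden_ratio \<le> 2" by (auto simp: golden_ratio_def)
  have "golden_ratio * golden_ratio ^ (n + 4) \<le> 2 * (4 * 2 ^ n)"
    using step.IH g by (intro mult_mono) auto
  moreover have "golden_ratio ^ (Suc n + 4) = golden_ratio * golden_ratio ^ (n + 4)"
    by (simp only: add_Suc power_Suc)
  ultimately show ?case by simp
qed

theorem theorem2:
  fixes n :: nat and p :: "nat \<Rightarrow> complex" and E :: "nat set set"
  assumes "n \<ge> 3"
    and "convex_polygon n p"
    and "polygon_triangulation n p E"
  shows "real (num_satisfying_states n p E) \<ge> golden_ratio ^ 2 * sqrt golden_ratio ^ n"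
proof -
  obtain \<Delta> where "triangulated_convex_polygon (n - 1) p E \<Delta>"
    using polygon_triangulation_tree[OF assms] .
  then have "4 * 2 ^ Suc (n - 1) \<le> (num_satisfying_states (Suc (n - 1)) p E)\<^sup>2"
    by (rule triangulated_convex_polygon.power2_num_satisfying_states_ge)
  then have "4 * 2 ^ n \<le> (num_satisfying_states n p E)\<^sup>2" using assms(1) by simp
  then have "real (4 * 2 ^ n) \<le> real ((num_satisfying_states n p E)\<^sup>2)"
    by (simp only: of_nat_le_iff)
  then have states: "4 * 2 ^ n \<le> (real (num_satisfying_states n p E))\<^sup>2" by simp
  have "golden_ratio \<ge> 0" by (simp add: golden_ratio_def)
  then have "(sqrt golden_ratio ^ n)\<^sup>2 = golden_ratio ^ n"
    by (metis mult.commute power_mult real_sqrt_pow2)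
  then have "(golden_ratio ^ 2 * sqrt golden_ratio ^ n)\<^sup>2 = golden_ratio ^ (n + 4)"
    by (simp add: power_mult_distrib power_add flip: power_mult)
  also have "\<dots> \<le> 4 * 2 ^ n" using assms(1) by (rule golden_ratio_power_le)
  also have "\<dots> \<le> (real (num_satisfying_states n p E))\<^sup>2" by (rule states)
  finally show ?thesis by (rule power2_le_imp_le) simp
qed

end
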